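(* Let $P=\frac1{100}P_1+\frac{99}{100}P_2$, where $P_1$ and $P_2$ are the uniform distributions on $[0,\frac13]$ and $[\frac23,1]$, respectively. The optimal set of three-means for $P$ is $\{\frac16,\frac34,\frac{11}{12}\}$, with quantization error $V_3=\frac{103}{43200}$.
   Context: For a Borel probability measure $P$ on $\mathbb{R}$ and $n\in\mathbb{N}$, the $n$th quantization error is $V_n=V_n(P)=\inf\{\int\min_{a\in\alpha}(x-a)^2\,dP(x) : \alpha\subset\mathbb{R},\ 1\le\mathrm{card}(\alpha)\le n\}$, and an optimal set of $n$-means for $P$ is a set $\alpha$ with $1\le\mathrm{card}(\alpha)\le n$ attaining this infimum. *)

theory Defs
  imports "HOL-Probability.Probability"
begin

text \<open>The distortion takes values in \<^typ>\<open>ennreal\<close>, so that it is \<open>\<infinity>\<close> (and not the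
  default value 0 of the Bochner integral) when the integrand is not integrable.\<close>

definition distortion :: "real measure \<Rightarrow> real set \<Rightarrow> ennreal" where
  "distortion P \<alpha> = (\<integral>\<^sup>+ x. ennreal (Min ((\<lambda>a. (x - a)\<^sup>2) ` \<alpha>)) \<partial>P)"

text \<open>Infinite sets have \<^const>\<open>card\<close> 0, so \<open>1 \<le> card \<alpha>\<close> makes \<open>\<alpha>\<close> finite and nonempty.\<close>

definition quantization_error :: "real measure \<Rightarrow> nat \<Rightarrow> ennreal" where
  "quantization_error P n = (INF \<alpha> \<in> {\<alpha>. 1 \<le> card \<alpha> \<and> card \<alpha> \<le> n}. distortion P \<alpha>)"

definition optimal_means :: "real measure \<Rightarrow> nat \<Rightarrow> real set \<Rightarrow> bool" where
  "optimal_means P n \<alpha> \<longleftrightarrow>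
     1 \<le> card \<alpha> \<and> card \<alpha> \<le> n \<and> distortion P \<alpha> = quantization_error P n"

text \<open>The measure \<open>p M + q N\<close>, meant for measures with \<open>sets N = sets M\<close> and \<open>p, q \<ge> 0\<close>.\<close>

definition weighted_sum_measure ::
  "real \<Rightarrow> 'a measure \<Rightarrow> real \<Rightarrow> 'a measure \<Rightarrow> 'a measure" where
  "weighted_sum_measure p M q N =
     measure_of (space M) (sets M) (\<lambda>A. ennreal p * emeasure M A + ennreal q * emeasure N A)"

lemma sets_weighted_sum_measure [simp, measurable_cong]:
  "sets (weighted_sum_measure p M q N) = sets M"
  by (simp add: weighted_sum_measure_def)

lemma space_weighted_sum_measure [simp]:
  "space (weighted_sum_measure p M q N) = space M"
  by (simp add: weighted_sum_measure_def)

lemma emeasure_weighted_sum_measure: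
  assumes "sets N = sets M" "A \<in> sets M"
  shows "emeasure (weighted_sum_measure p M q N) A
           = ennreal p * emeasure M A + ennreal q * emeasure N A"
  unfolding weighted_sum_measure_def
proof (rule emeasure_measure_of_sigma)
  show "sigma_algebra (space M) (sets M)" ..
  show "positive (sets M) (\<lambda>A. ennreal p * emeasure M A + ennreal q * emeasure N A)"
    by (simp add: positive_def)
  show "countably_additive (sets M) (\<lambda>A. ennreal p * emeasure M A + ennreal q * emeasure N A)"
  proof (rule countably_additiveI)
    fix B :: "nat \<Rightarrow> 'a set"
    assume B: "range B \<subseteq> sets M" "disjoint_family B"
    then have "(\<Sum>i. emeasure M (B i)) = emeasure M (\<Union>i. B i)"
      and "(\<Sum>i. emeasure N (B i)) = emeasure N (\<Union>i. B i)"
      using assms(1) by (auto intro!: suminf_emeasure)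
    then show "(\<Sum>i. ennreal p * emeasure M (B i) + ennreal q * emeasure N (B i))
        = ennreal p * emeasure M (\<Union>i. B i) + ennreal q * emeasure N (\<Union>i. B i)"
      by (simp add: suminf_add[symmetric] ennreal_suminf_cmult)
  qed
qed fact

lemma prob_space_weighted_sum_measure:
  assumes "prob_space M" "prob_space N" "sets N = sets M" "0 \<le> p" "0 \<le> q" "p + q = 1"
  shows "prob_space (weighted_sum_measure p M q N)"
proof (rule prob_spaceI)
  have "space N = space M"
    using assms(3) by (rule sets_eq_imp_space_eq)
  then show "emeasure (weighted_sum_measure p M q N) (space (weighted_sum_measure p M q N)) = 1"
    using assms prob_space.emeasure_space_1[OF assms(1)] prob_space.emeasure_space_1[OF assms(2)]
    by (simp add: emeasure_weighted_sum_measure flip: ennreal_plus)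
qed

end

theory Submission
  imports Defs
begin

text \<open>
  Write the candidate as \<open>a \<le> b \<le> c\<close>, repetitions allowed, so that sets with fewer than three
  points are included. As \<open>P\<close> has density \<open>3/100\<close> on \<open>[0, 1/3]\<close> and \<open>297/100\<close> on \<open>[2/3, 1]\<close>,
  its distortion is \<open>cost3 a b c\<close>, a combination of two integrals of the squared distance to the
  nearest of the three points. The light left interval deserves one point and the heavy right
  interval two; what has to be excluded is that moving points across pays off. The decisive
  quantity is the midpoint of \<open>a\<close> and \<open>b\<close>, where the cell of \<open>a\<close> ends.

  If that midpoint is at most \<open>2/3\<close> (\<open>cost3_separated\<close>), the right interval is served by \<open>b\<close> and
  \<open>c\<close> alone. Two points cost at least \<open>L\<^sup>3/48\<close> on an interval of length \<open>L\<close>, with equality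
  only at the quarter points (\<open>two_point_bound\<close>). The left interval costs at least as much as
  with its centre as the only point, because \<open>b > 2/3\<close> is too far away to help; and
  \<open>b \<le> 2/3\<close> is hopeless, since it makes the right interval alone too expensive
  (\<open>two_point_cost_left_outside\<close>). Both minima are attained together only at the claimed points.

  If the midpoint exceeds \<open>2/3\<close> (\<open>cost3_overlapping\<close>), the left interval is served by \<open>a\<close>
  alone, and the bound is strict. Either \<open>a\<close> is so far right that the left interval, together with
  the three-point lower bound \<open>L\<^sup>3/108\<close> on the right one (\<open>three_point_bound\<close>), costs too much;
  or \<open>a\<close> is further left, and then \<open>b\<close>, at least as far beyond \<open>2/3\<close> as \<open>a\<close> is before it, leaves
  the beginning of the right interval badly served.
\<close>

section \<open>Measures given by densities\<close>

lemma weighted_sum_density: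
  assumes [measurable]: "f \<in> borel_measurable M" "g \<in> borel_measurable M"
  shows "weighted_sum_measure p (density M f) q (density M g)
           = density M (\<lambda>x. ennreal p * f x + ennreal q * g x)"
proof (rule measure_eqI)
  fix A assume "A \<in> sets (weighted_sum_measure p (density M f) q (density M g))"
  then have [measurable]: "A \<in> sets M" by simp
  show "emeasure (weighted_sum_measure p (density M f) q (density M g)) A
          = emeasure (density M (\<lambda>x. ennreal p * f x + ennreal q * g x)) A"
    by (simp add: emeasure_weighted_sum_measure emeasure_density distrib_right mult.assoc
        nn_integral_add nn_integral_cmult)
qed simp

lemma nn_integral_weighted_uniform:
  fixes u v s t p q :: real and h :: "real \<Rightarrow> real"
  assumes "u < v" "s < t" "0 \<le> p" "0 \<le> q"
    and h: "continuous_on UNIV h" "\<And>x. 0 \<le> h x"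
  shows "(\<integral>\<^sup>+ x. ennreal (h x) \<partial>weighted_sum_measure p (uniform_measure lborel {u..v})
                                             q (uniform_measure lborel {s..t}))
           = ennreal (p / (v - u) * integral {u..v} h + q / (t - s) * integral {s..t} h)"
proof -
  have [measurable]: "h \<in> borel_measurable borel"
    using h(1) by (rule borel_measurable_continuous_onI)
  have part: "(\<integral>\<^sup>+ x. ennreal r * (indicator {k..l} x / emeasure lborel {k..l}) * ennreal (h x) \<partial>lborel)
      = ennreal (r / (l - k) * integral {k..l} h)" (is "?L = _")
    if "k < l" "0 \<le> r" for k l r :: real
  proof -
    have int: "(h has_integral integral {k..l} h) {k..l}"
      using h(1) by (intro integrable_integral integrable_continuous_interval)
        (rule continuous_on_subset, auto)
    have "?L = (\<integral>\<^sup>+ x. ennreal (r / (l - k)) * (indicator {k..l} x * ennreal (h x)) \<partial>lborel)"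
      using that h(2)
      by (intro nn_integral_cong)
        (auto simp: divide_ennreal ennreal_1[symmetric] indicator_def simp del: ennreal_1
          simp flip: ennreal_mult)
    also have "\<dots> = ennreal (r / (l - k)) * (\<integral>\<^sup>+ x. indicator {k..l} x * ennreal (h x) \<partial>lborel)"
      by (rule nn_integral_cmult) simp
    also have "(\<integral>\<^sup>+ x. indicator {k..l} x * ennreal (h x) \<partial>lborel)
        = ennreal (integral {k..l} h)"
      using nn_integral_has_integral_lebesgue[OF _ int] h(2)
      by (simp add: nn_integral_completion ennreal_mult ennreal_indicator)
    also have "ennreal (r / (l - k)) * ennreal (integral {k..l} h)
        = ennreal (r / (l - k) * integral {k..l} h)"
      using that h(2) int
      by (intro ennreal_mult[symmetric]) (auto intro: has_integral_nonneg)
    finally show ?thesis .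
  qed
  have nonneg: "0 \<le> r / (l - k) * integral {k..l} h" if "k < l" "0 \<le> r" for k l r :: real
    using that h by (intro mult_nonneg_nonneg integral_nonneg integrable_continuous_interval)
      (auto intro: continuous_on_subset)
  have "(\<integral>\<^sup>+ x. ennreal (h x) \<partial>weighted_sum_measure p (uniform_measure lborel {u..v})
                                             q (uniform_measure lborel {s..t}))
      = ennreal (p / (v - u) * integral {u..v} h) + ennreal (q / (t - s) * integral {s..t} h)"
    unfolding uniform_measure_def
    using assms(1-4)
    by (simp add: weighted_sum_density nn_integral_density distrib_right nn_integral_add part
        del: emeasure_lborel_Icc emeasure_lborel_Icc_eq)
  also have "\<dots> = ennreal (p / (v - u) * integral {u..v} h + q / (t - s) * integral {s..t} h)"
    using assms(1-4) by (intro ennreal_plus[symmetric] nonneg)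
  finally show ?thesis .
qed

section \<open>Quantizing an interval\<close>

lemma has_integral_cell:
  fixes u v a :: real
  assumes "u \<le> v"
  shows "((\<lambda>x. (x - a)\<^sup>2) has_integral (v - u)^3 / 12 + (v - u) * ((u + v) / 2 - a)\<^sup>2) {u..v}"
proof -
  have "((\<lambda>x. (x - a)\<^sup>2) has_integral ((v - a)^3 / 3 - (u - a)^3 / 3)) {u..v}"
    using assms
    by (intro fundamental_theorem_of_calculus)
      (auto intro!: derivative_eq_intros simp flip: has_real_derivative_iff_has_vector_derivative)
  also have "(v - a)^3 / 3 - (u - a)^3 / 3 = (v - u)^3 / 12 + (v - u) * ((u + v) / 2 - a)\<^sup>2"
    by (simp add: field_simps power2_eq_square power3_eq_cube)
  finally show ?thesis .
qed

lemma nearer_left: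
  fixes x a b :: real
  assumes "a \<le> b" "x \<le> (a + b) / 2"
  shows "(x - a)\<^sup>2 \<le> (x - b)\<^sup>2"
  unfolding abs_le_square_iff[symmetric] using assms by auto

lemma nearer_right:
  fixes x a b :: real
  assumes "a \<le> b" "(a + b) / 2 \<le> x"
  shows "(x - b)\<^sup>2 \<le> (x - a)\<^sup>2"
  unfolding abs_le_square_iff[symmetric] using assms by auto

text \<open>The interval splits at a point \<open>p\<close> into the cells of \<open>b\<close> and \<open>c\<close>. Each cell contributes, by the
  parallel axis theorem, the cost of its centre plus its length times the squared offset of the
  serving point from the centre.\<close>

lemma two_point_cells:
  fixes u v b c :: real
  assumes "u \<le> v" "b \<le> c"
  obtains p where "u \<le> p" "p \<le> v"
    "integral {u..v} (\<lambda>x. min ((x - b)\<^sup>2) ((x - c)\<^sup>2))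
       = (p - u)^3 / 12 + (p - u) * ((u + p) / 2 - b)\<^sup>2
         + ((v - p)^3 / 12 + (v - p) * ((p + v) / 2 - c)\<^sup>2)"
proof -
  let ?h = "\<lambda>x. min ((x - b)\<^sup>2) ((x - c)\<^sup>2)"
  let ?m = "(b + c) / 2"
  \<comment> \<open>The midpoint may lie outside the interval; then one of the two cells is a single point, where
    the integrand may differ from the squared distance used. Hence the finite exceptional sets below.\<close>
  define p where "p = max u (min v ?m)"
  have p: "u \<le> p" "p \<le> v" using assms by (auto simp: p_def)
  have "(?h has_integral ((p - u)^3 / 12 + (p - u) * ((u + p) / 2 - b)\<^sup>2)) {u..p}"
  proof (rule has_integral_spike_finite[OF _ _ has_integral_cell])
    fix x assume "x \<in> {u..p} - {u}"
    then have "x \<le> ?m" by (auto simp: p_def max_def min_def split: if_splits)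
    then show "?h x = (x - b)\<^sup>2" using nearer_left[OF assms(2)] by (simp add: min_absorb1)
  qed (use p in auto)
  moreover have "(?h has_integral ((v - p)^3 / 12 + (v - p) * ((p + v) / 2 - c)\<^sup>2)) {p..v}"
  proof (rule has_integral_spike_finite[OF _ _ has_integral_cell])
    fix x assume "x \<in> {p..v} - {v}"
    then have "?m \<le> x" by (auto simp: p_def max_def min_def split: if_splits)
    then show "?h x = (x - c)\<^sup>2" using nearer_right[OF assms(2)] by (simp add: min_absorb2)
  qed (use p in auto)
  ultimately show thesis
    using p has_integral_combine[of u p v] that integral_unique by meson
qed

text \<open>With cells of lengths \<open>s\<close> and \<open>t\<close> the cost exceeds \<open>(s + t)\<^sup>3/48\<close> by nonnegative terms, one
  measuring the inequality of the cells and two the offsets of the points from the cell centres.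
  Equality therefore forces equal cells served by their centres.\<close>

lemma two_point_bound:
  fixes u v b c :: real
  assumes "u \<le> v" "b \<le> c"
  defines "I \<equiv> integral {u..v} (\<lambda>x. min ((x - b)\<^sup>2) ((x - c)\<^sup>2))"
  shows "(v - u)^3 / 48 \<le> I"
    and "u < v \<Longrightarrow> I = (v - u)^3 / 48 \<Longrightarrow> b = u + (v - u) / 4 \<and> c = u + 3 * (v - u) / 4"
proof -
  obtain p where p: "u \<le> p" "p \<le> v"
    and I: "I = (p - u)^3 / 12 + (p - u) * ((u + p) / 2 - b)\<^sup>2
         + ((v - p)^3 / 12 + (v - p) * ((p + v) / 2 - c)\<^sup>2)"
    unfolding I_def by (rule two_point_cells[OF assms(1,2)])
  have cubes: "s^3 / 12 + t^3 / 12 = (s + t)^3 / 48 + (s + t) * (s - t)\<^sup>2 / 16" for s t :: real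
    by (simp add: field_simps power2_eq_square power3_eq_cube)
  have I': "I = (v - u)^3 / 48 + ((v - u) * (u + v - 2 * p)\<^sup>2 / 16
      + (p - u) * ((u + p) / 2 - b)\<^sup>2 + (v - p) * ((p + v) / 2 - c)\<^sup>2)"
    using cubes[of "v - p" "p - u"] unfolding I by (simp add: algebra_simps)
  have nn: "0 \<le> (v - u) * (u + v - 2 * p)\<^sup>2 / 16" "0 \<le> (p - u) * ((u + p) / 2 - b)\<^sup>2"
    "0 \<le> (v - p) * ((p + v) / 2 - c)\<^sup>2"
    using p by auto
  show "(v - u)^3 / 48 \<le> I" using I' nn by linarith
  assume uv: "u < v" and eq: "I = (v - u)^3 / 48"
  have z: "(v - u) * (u + v - 2 * p)\<^sup>2 / 16 = 0" "(p - u) * ((u + p) / 2 - b)\<^sup>2 = 0"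
    "(v - p) * ((p + v) / 2 - c)\<^sup>2 = 0"
    using I' nn eq by linarith+
  have pm: "p = (u + v) / 2" using z(1) uv by simp
  then have "(u + p) / 2 - b = 0" "(p + v) / 2 - c = 0" using z uv by auto
  then show "b = u + (v - u) / 4 \<and> c = u + 3 * (v - u) / 4" using pm by (simp add: field_simps)
qed

lemma cube_tangent:
  fixes s k :: real
  assumes "0 \<le> s" "0 \<le> k"
  shows "3 * k\<^sup>2 * s - 2 * k^3 \<le> s^3"
proof -
  have "s^3 - (3 * k\<^sup>2 * s - 2 * k^3) = (s - k)\<^sup>2 * (s + 2 * k)"
    by (simp add: field_simps power2_eq_square power3_eq_cube)
  moreover have "0 \<le> (s - k)\<^sup>2 * (s + 2 * k)" using assms by simp
  ultimately show ?thesis by linarith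
qed

text \<open>For a fixed sum, the right-hand side is least at \<open>t = 2 s\<close>. The proof adds the tangents of the
  two cubes there, whose slopes agree, so that only the sum of \<open>s\<close> and \<open>t\<close> remains.\<close>

lemma cubes_weighted_bound:
  fixes s t :: real
  assumes "0 \<le> s" "0 \<le> t"
  shows "(s + t)^3 / 27 \<le> s^3 / 3 + t^3 / 12"
proof -
  define k where "k = (s + t) / 3"
  have "3 * k\<^sup>2 * s - 2 * k^3 \<le> s^3" "3 * (2 * k)\<^sup>2 * t - 2 * (2 * k)^3 \<le> t^3"
    using assms by (auto intro!: cube_tangent simp: k_def)
  moreover have "(s + t)^3 / 27 = k^3" by (simp add: k_def power_divide)
  moreover have "3 * k^3 = k\<^sup>2 * s + k\<^sup>2 * t"
    by (simp add: k_def power3_eq_cube power2_eq_square field_simps)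
  ultimately show ?thesis by (simp add: power_mult_distrib)
qed

section \<open>The cost of three points\<close>

text \<open>A point to the left of the interval serves its cell at least as badly as an end point of that cell
  would, and so pays for a cell of length \<open>s\<close> at least \<open>s\<^sup>3/3\<close> instead of \<open>s\<^sup>3/12\<close>.\<close>

lemma two_point_cost_left_outside:
  fixes u v b c :: real
  assumes "u \<le> v" "b \<le> c" "b \<le> u"
  shows "(v - u)^3 / 27 \<le> integral {u..v} (\<lambda>x. min ((x - b)\<^sup>2) ((x - c)\<^sup>2))"
proof -
  obtain p where p: "u \<le> p" "p \<le> v"
    and I: "integral {u..v} (\<lambda>x. min ((x - b)\<^sup>2) ((x - c)\<^sup>2))
       = (p - u)^3 / 12 + (p - u) * ((u + p) / 2 - b)\<^sup>2
         + ((v - p)^3 / 12 + (v - p) * ((p + v) / 2 - c)\<^sup>2)"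
    by (rule two_point_cells[OF assms(1,2)])
  have "((p - u) / 2)\<^sup>2 \<le> ((u + p) / 2 - b)\<^sup>2"
    using p assms by (intro power_mono) (auto simp: field_simps)
  then have "(p - u) * ((p - u) / 2)\<^sup>2 \<le> (p - u) * ((u + p) / 2 - b)\<^sup>2"
    using p by (intro mult_left_mono) auto
  moreover have "(p - u) * ((p - u) / 2)\<^sup>2 = (p - u)^3 / 4"
    by (simp add: power2_eq_square power3_eq_cube)
  moreover have "0 \<le> (v - p) * ((p + v) / 2 - c)\<^sup>2" using p by simp
  ultimately have "(p - u)^3 / 3 + (v - p)^3 / 12
      \<le> integral {u..v} (\<lambda>x. min ((x - b)\<^sup>2) ((x - c)\<^sup>2))"
    unfolding I by linarith
  moreover have "(v - u)^3 / 27 \<le> (p - u)^3 / 3 + (v - p)^3 / 12"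
    using cubes_weighted_bound[of "p - u" "v - p"] p by simp
  ultimately show ?thesis by linarith
qed

abbreviation sqdist3 :: "real \<Rightarrow> real \<Rightarrow> real \<Rightarrow> real \<Rightarrow> real" where
  "sqdist3 a b c x \<equiv> min ((x - a)\<^sup>2) (min ((x - b)\<^sup>2) ((x - c)\<^sup>2))"

lemma sqdist3_integrable: "sqdist3 a b c integrable_on {u..v}"
  by (intro integrable_continuous_interval continuous_intros)

text \<open>Beyond the midpoint of \<open>a\<close> and \<open>b\<close> only two points are active, so that \<open>two_point_bound\<close>
  applies to the rest of the interval. The optimal rest is twice as long as the first cell, which is
  again the trade-off of \<open>cubes_weighted_bound\<close>.\<close>

lemma three_point_bound:
  fixes a b c u v :: real
  assumes "u \<le> v" "a \<le> b" "b \<le> c" "u \<le> (a + b) / 2"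
  shows "(v - u)^3 / 108 \<le> integral {u..v} (sqdist3 a b c)"
proof -
  define p where "p = min v ((a + b) / 2)"
  have p: "u \<le> p" "p \<le> v" using assms by (auto simp: p_def)
  have "integral {u..p} (sqdist3 a b c) = integral {u..p} (\<lambda>x. (x - a)\<^sup>2)"
  proof (rule integral_cong)
    fix x assume "x \<in> {u..p}"
    then have "(x - a)\<^sup>2 \<le> (x - b)\<^sup>2" "(x - a)\<^sup>2 \<le> (x - c)\<^sup>2"
      using assms by (auto intro!: nearer_left simp: p_def)
    then show "sqdist3 a b c x = (x - a)\<^sup>2" by simp
  qed
  also have "\<dots> = (p - u)^3 / 12 + (p - u) * ((u + p) / 2 - a)\<^sup>2"
    using p by (intro integral_unique has_integral_cell)
  finally have 1: "(p - u)^3 / 12 \<le> integral {u..p} (sqdist3 a b c)" using p by simp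
  have "integral {p..v} (sqdist3 a b c) = integral {p..v} (\<lambda>x. min ((x - b)\<^sup>2) ((x - c)\<^sup>2))"
  proof (rule integral_spike[of "{v}"])
    fix x assume "x \<in> {p..v} - {v}"
    then have "(x - b)\<^sup>2 \<le> (x - a)\<^sup>2"
      using assms by (intro nearer_right) (auto simp: p_def min_def split: if_splits)
    then show "min ((x - b)\<^sup>2) ((x - c)\<^sup>2) = sqdist3 a b c x" by simp
  qed auto
  then have 2: "(v - p)^3 / 48 \<le> integral {p..v} (sqdist3 a b c)"
    using two_point_bound(1)[of p v b c] p assms by simp
  have 3: "integral {u..p} (sqdist3 a b c) + integral {p..v} (sqdist3 a b c)
      = integral {u..v} (sqdist3 a b c)"
    using p sqdist3_integrable by (intro Henstock_Kurzweil_Integration.integral_combine)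
  have "(v - u)^3 / 27 \<le> (p - u)^3 / 3 + (v - p)^3 / 12"
    using cubes_weighted_bound[of "p - u" "v - p"] p by simp
  with 1 2 3 show ?thesis by linarith
qed

text \<open>The distortion of \<open>{a, b, c}\<close> for \<open>P\<close>: the factors are the two weights divided by the interval
  length \<open>1/3\<close>.\<close>

definition cost3 :: "real \<Rightarrow> real \<Rightarrow> real \<Rightarrow> real" where
  "cost3 a b c = 3/100 * integral {0..1/3} (sqdist3 a b c)
               + 297/100 * integral {2/3..1} (sqdist3 a b c)"

text \<open>The two intervals are optimized independently: \<open>b\<close> and \<open>c\<close> on the right, and on the left the
  single point \<open>a\<close>, moved to \<open>0\<close> if it is negative.\<close>

lemma cost3_separated:
  fixes a b c :: real
  assumes "a \<le> b" "b \<le> c" "(a + b) / 2 \<le> 2/3"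
  shows "103/43200 \<le> cost3 a b c"
    and "cost3 a b c = 103/43200 \<Longrightarrow> a = 1/6 \<and> b = 3/4 \<and> c = 11/12"
proof -
  let ?I = "integral {0..1/3} (sqdist3 a b c)" and ?J = "integral {2/3..1} (sqdist3 a b c)"
  have J: "?J = integral {2/3..1} (\<lambda>x. min ((x - b)\<^sup>2) ((x - c)\<^sup>2))"
  proof (rule integral_cong)
    fix x :: real assume "x \<in> {2/3..1}"
    then have "(x - b)\<^sup>2 \<le> (x - a)\<^sup>2" using assms by (intro nearer_right) auto
    then show "sqdist3 a b c x = min ((x - b)\<^sup>2) ((x - c)\<^sup>2)" by simp
  qed
  have J1: "1/1296 \<le> ?J" "?J = 1/1296 \<Longrightarrow> b = 3/4 \<and> c = 11/12"
    using two_point_bound[of "2/3" 1 b c] assms(2) J by (auto simp: power3_eq_cube)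
  have "103/43200 \<le> cost3 a b c \<and> (cost3 a b c = 103/43200 \<longrightarrow> a = 1/6 \<and> b = 3/4 \<and> c = 11/12)"
  proof (cases "b \<le> 2/3")
    case True
    have "0 \<le> ?I" by (rule integral_nonneg[OF sqdist3_integrable]) simp
    moreover have "1/729 \<le> ?J"
      using two_point_cost_left_outside[of "2/3" 1 b c] True assms J by (simp add: power3_eq_cube)
    ultimately have "103/43200 < cost3 a b c" unfolding cost3_def by linarith
    then show ?thesis by simp
  next
    case False
    \<comment> \<open>A very negative \<open>a\<close> could lose part of the left interval to \<open>b\<close>. Replacing such an \<open>a\<close> by \<open>0\<close>
      removes this case, as \<open>0\<close> is nearer than any point beyond \<open>2/3\<close> to all of \<open>[0, 1/3]\<close>.\<close>
    define a' where "a' = max a 0"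
    have "integral {0..1/3} (\<lambda>x. (x - a')\<^sup>2) \<le> ?I"
    proof (rule integral_le)
      fix x :: real assume x: "x \<in> {0..1/3}"
      have "(x - a')\<^sup>2 \<le> (x - a)\<^sup>2"
        using x by (auto simp: a'_def max_def abs_le_square_iff[symmetric])
      moreover have "(x - a')\<^sup>2 \<le> (x - b)\<^sup>2" "(x - a')\<^sup>2 \<le> (x - c)\<^sup>2"
        using x assms False by (intro nearer_left; auto simp: a'_def max_def)+
      ultimately show "(x - a')\<^sup>2 \<le> sqdist3 a b c x" by simp
    qed (auto intro!: integrable_continuous_interval continuous_intros)
    moreover have "integral {0..1/3} (\<lambda>x. (x - a')\<^sup>2) = 1/324 + 1/3 * (1/6 - a')\<^sup>2"
      using integral_unique[OF has_integral_cell[of 0 "1/3" a']] by (simp add: power3_eq_cube)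
    ultimately have I: "1/324 + 1/3 * (1/6 - a')\<^sup>2 \<le> ?I" by simp
    have sq: "0 \<le> (1/6 - a')\<^sup>2" by simp
    have "103/43200 \<le> cost3 a b c" unfolding cost3_def using I J1(1) sq by linarith
    moreover have "a = 1/6 \<and> b = 3/4 \<and> c = 11/12" if "cost3 a b c = 103/43200"
    proof -
      have "?J = 1/1296" "(1/6 - a')\<^sup>2 = 0"
        using that I J1(1) sq unfolding cost3_def by linarith+
      then show ?thesis using J1(2) by (auto simp: a'_def max_def split: if_splits)
    qed
    ultimately show ?thesis by blast
  qed
  then show "103/43200 \<le> cost3 a b c"
    and "cost3 a b c = 103/43200 \<Longrightarrow> a = 1/6 \<and> b = 3/4 \<and> c = 11/12" by auto
qed

text \<open>The threshold \<open>53/100\<close> for \<open>a\<close> balances the two ways to lose: above it the left interval is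
  expensive, below it the part of the right interval between \<open>2/3\<close> and \<open>b\<close> is.\<close>

lemma cost3_overlapping:
  fixes a b c :: real
  assumes "a \<le> b" "b \<le> c" "2/3 < (a + b) / 2"
  shows "103/43200 < cost3 a b c"
proof -
  let ?I = "integral {0..1/3} (sqdist3 a b c)" and ?J = "integral {2/3..1} (sqdist3 a b c)"
  have I0: "0 \<le> ?I" by (rule integral_nonneg[OF sqdist3_integrable]) simp
  show ?thesis
  proof (cases "53/100 \<le> a")
    case True
    have "?I = integral {0..1/3} (\<lambda>x. (x - a)\<^sup>2)"
    proof (rule integral_cong)
      fix x :: real assume "x \<in> {0..1/3}"
      then have "(x - a)\<^sup>2 \<le> (x - b)\<^sup>2" "(x - a)\<^sup>2 \<le> (x - c)\<^sup>2"
        using assms by (auto intro!: nearer_left)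
      then show "sqdist3 a b c x = (x - a)\<^sup>2" by simp
    qed
    then have I: "?I = 1/324 + 1/3 * (a - 1/6)\<^sup>2"
      using integral_unique[OF has_integral_cell[of 0 "1/3" a]]
      by (simp add: power3_eq_cube power2_commute)
    have "(53/100 - 1/6)\<^sup>2 \<le> (a - 1/6)\<^sup>2" using True by (intro power_mono) auto
    then have "(109/300)\<^sup>2 \<le> (a - 1/6)\<^sup>2" by simp
    then have "11881/90000 \<le> (a - 1/6)\<^sup>2" by (simp add: power2_eq_square)
    moreover have "1/2916 \<le> ?J"
      using three_point_bound[of "2/3" 1 a b c] assms by (simp add: power3_eq_cube)
    ultimately have "3/100 * (1/324 + 1/3 * (11881/90000)) + 297/100 * (1/2916) \<le> cost3 a b c"
      unfolding cost3_def I by (intro add_mono mult_left_mono) auto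
    then show ?thesis by simp
  next
    case False
    \<comment> \<open>The mirror image of the threshold at \<open>2/3\<close>: as \<open>a\<close> lies left of the threshold, \<open>b\<close> lies right of
      \<open>?r\<close>, and so \<open>?r\<close> serves all of \<open>[2/3, ?r]\<close> at least as well as \<open>a\<close>, \<open>b\<close> and \<open>c\<close> do.\<close>
    let ?r = "4/3 - 53/100 :: real"
    have "integral {2/3..?r} (\<lambda>x. (x - ?r)\<^sup>2) \<le> integral {2/3..?r} (sqdist3 a b c)"
    proof (rule integral_le)
      fix x :: real assume x: "x \<in> {2/3..?r}"
      have "(x - ?r)\<^sup>2 \<le> (x - a)\<^sup>2" "(x - ?r)\<^sup>2 \<le> (x - b)\<^sup>2" "(x - ?r)\<^sup>2 \<le> (x - c)\<^sup>2"
        unfolding abs_le_square_iff[symmetric] using x assms False by auto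
      then show "(x - ?r)\<^sup>2 \<le> sqdist3 a b c x" by simp
    qed (auto intro!: integrable_continuous_interval continuous_intros)
    moreover have "integral {2/3..?r} (\<lambda>x. (x - ?r)\<^sup>2) = 68921/81000000"
      using integral_unique[OF has_integral_cell[of "2/3" ?r ?r]]
      by (simp add: power3_eq_cube power2_eq_square)
    moreover have "integral {2/3..?r} (sqdist3 a b c) \<le> ?J"
      by (rule integral_subset_le) (auto intro: sqdist3_integrable)
    ultimately show ?thesis unfolding cost3_def using I0 by linarith
  qed
qed

lemma cost3_optimum: "cost3 (1/6) (3/4) (11/12) = 103/43200"
proof -
  let ?h = "sqdist3 (1/6) (3/4) (11/12)"
  have 1: "integral {0..1/3} ?h = integral {0..1/3} (\<lambda>x. (x - 1/6)\<^sup>2)"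
  proof (rule integral_cong)
    fix x :: real assume "x \<in> {0..1/3}"
    then have "(x - 1/6)\<^sup>2 \<le> (x - 3/4)\<^sup>2" "(x - 1/6)\<^sup>2 \<le> (x - 11/12)\<^sup>2"
      unfolding abs_le_square_iff[symmetric] by auto
    then show "?h x = (x - 1/6)\<^sup>2" by simp
  qed
  have 2: "integral {2/3..5/6} ?h = integral {2/3..5/6} (\<lambda>x. (x - 3/4)\<^sup>2)"
  proof (rule integral_cong)
    fix x :: real assume "x \<in> {2/3..5/6}"
    then have "(x - 3/4)\<^sup>2 \<le> (x - 1/6)\<^sup>2" "(x - 3/4)\<^sup>2 \<le> (x - 11/12)\<^sup>2"
      unfolding abs_le_square_iff[symmetric] by auto
    then show "?h x = (x - 3/4)\<^sup>2" by simp
  qed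
  have 3: "integral {5/6..1} ?h = integral {5/6..1} (\<lambda>x. (x - 11/12)\<^sup>2)"
  proof (rule integral_cong)
    fix x :: real assume "x \<in> {5/6..1}"
    then have "(x - 11/12)\<^sup>2 \<le> (x - 1/6)\<^sup>2" "(x - 11/12)\<^sup>2 \<le> (x - 3/4)\<^sup>2"
      unfolding abs_le_square_iff[symmetric] by auto
    then show "?h x = (x - 11/12)\<^sup>2" by simp
  qed
  have 4: "integral {2/3..5/6} ?h + integral {5/6..1} ?h = integral {2/3..1} ?h"
    by (intro Henstock_Kurzweil_Integration.integral_combine sqdist3_integrable) auto
  show ?thesis
    using 1 2 3 4 integral_unique[OF has_integral_cell[of 0 "1/3" "1/6"]]
      integral_unique[OF has_integral_cell[of "2/3" "5/6" "3/4"]]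
      integral_unique[OF has_integral_cell[of "5/6" 1 "11/12"]]
    by (simp add: cost3_def power3_eq_cube)
qed

section \<open>Optimal sets of three means\<close>

lemma sorted_triple:
  fixes \<alpha> :: "'a::linorder set"
  assumes "1 \<le> card \<alpha>" "card \<alpha> \<le> 3"
  obtains a b c where "\<alpha> = {a, b, c}" "a \<le> b" "b \<le> c"
proof -
  have "card \<alpha> = 1 \<or> card \<alpha> = 2 \<or> card \<alpha> = 3" using assms by linarith
  then obtain x y z where xyz: "\<alpha> = {x, y, z}"
    by (metis card_1_singletonE card_2_iff card_3_iff insert_absorb2)
  consider "x \<le> y" "y \<le> z" | "x \<le> z" "z \<le> y" | "y \<le> x" "x \<le> z"
    | "y \<le> z" "z \<le> x" | "z \<le> x" "x \<le> y" | "z \<le> y" "y \<le> x"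
    by (meson linear)
  then show thesis
  proof cases
    case 1 then show thesis using that[of x y z] xyz by auto
  next
    case 2 then show thesis using that[of x z y] xyz by auto
  next
    case 3 then show thesis using that[of y x z] xyz by auto
  next
    case 4 then show thesis using that[of y z x] xyz by auto
  next
    case 5 then show thesis using that[of z x y] xyz by auto
  next
    case 6 then show thesis using that[of z y x] xyz by auto
  qed
qed

theorem proposition3p4p2:
  fixes P1 P2 P :: "real measure"
  defines "P1 \<equiv> uniform_measure lborel {0..1/3}"
    and "P2 \<equiv> uniform_measure lborel {2/3..1}"
    and "P \<equiv> weighted_sum_measure (1/100) P1 (99/100) P2"
  shows "(\<forall>\<alpha>. optimal_means P 3 \<alpha> \<longleftrightarrow> \<alpha> = {1/6, 3/4, 11/12})
    \<and> quantization_error P 3 = ennreal (103/43200)"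
proof -
  let ?opt = "{1/6, 3/4, 11/12} :: real set"
  have dist: "distortion P {a, b, c} = ennreal (cost3 a b c)" for a b c
  proof -
    have "distortion P {a, b, c} = (\<integral>\<^sup>+ x. ennreal (sqdist3 a b c x) \<partial>P)"
      unfolding distortion_def by simp
    also have "\<dots> = ennreal (cost3 a b c)"
      unfolding P_def P1_def P2_def cost3_def
      by (subst nn_integral_weighted_uniform) (auto intro!: continuous_intros)
    finally show ?thesis .
  qed
  have opt: "distortion P ?opt = ennreal (103/43200)"
    by (simp only: dist cost3_optimum)
  have card_opt: "card ?opt = 3" by simp
  have lower: "ennreal (103/43200) \<le> distortion P \<alpha>
      \<and> (distortion P \<alpha> = ennreal (103/43200) \<longrightarrow> \<alpha> = ?opt)"
    if \<alpha>: "1 \<le> card \<alpha>" "card \<alpha> \<le> 3" for \<alpha>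
  proof -
    obtain a b c where abc: "\<alpha> = {a, b, c}" "a \<le> b" "b \<le> c"
      using sorted_triple[OF \<alpha>] .
    have ge: "103/43200 \<le> cost3 a b c"
      using cost3_separated(1)[OF abc(2,3)] cost3_overlapping[OF abc(2,3)] by fastforce
    moreover have "\<alpha> = ?opt" if "cost3 a b c = 103/43200"
      using cost3_separated(2)[OF abc(2,3)] cost3_overlapping[OF abc(2,3)] that abc(1) by fastforce
    ultimately show ?thesis
      unfolding abc(1) dist by (auto simp: ennreal_leI)
  qed
  have V: "quantization_error P 3 = ennreal (103/43200)"
    unfolding quantization_error_def
  proof (rule antisym)
    show "(INF \<alpha>\<in>{\<alpha>. 1 \<le> card \<alpha> \<and> card \<alpha> \<le> 3}. distortion P \<alpha>) \<le> ennreal (103/43200)"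
      by (rule INF_lower2[of ?opt]) (simp_all only: opt card_opt mem_Collect_eq, simp)
    show "ennreal (103/43200) \<le> (INF \<alpha>\<in>{\<alpha>. 1 \<le> card \<alpha> \<and> card \<alpha> \<le> 3}. distortion P \<alpha>)"
      using lower by (intro INF_greatest) blast
  qed
  have "optimal_means P 3 \<alpha> \<longleftrightarrow> \<alpha> = ?opt" for \<alpha>
  proof
    assume "optimal_means P 3 \<alpha>"
    then show "\<alpha> = ?opt" unfolding optimal_means_def V using lower by blast
  next
    assume "\<alpha> = ?opt"
    then show "optimal_means P 3 \<alpha>"
      unfolding optimal_means_def V using opt card_opt by simp
  qed
  with V show ?thesis by blast
qed

end
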